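(* Let $d \ge 1$, $L > 0$, let $f \in \mathcal{F}_L^1(\mathbb{R}^d)$ have a minimizer $x^\star$, and let $r \ge 2$ be a real number. For any step size $0 < s \le 1/L$ and any initial point $x_0 = y_0 \in \mathbb{R}^d$, the iterates $\{y_k\}_{k=0}^\infty$ generated by \texttt{NAG} satisfy, for all integers $k \ge 0$, $$f(y_k) - f(x^\star) \le \frac{r^2 \|x_0 - x^\star\|^2}{2s(k+1)(k+r+1)}, \qquad \min_{0 \le i \le k} \|\nabla f(y_i)\|^2 \le \frac{6 r^2 \|x_0 - x^\star\|^2}{s^2 (k+1)(k+2)(2k+3r+3)};$$ furthermore, $$\lim_{k \to \infty} \left( k^3 \min_{0 \le i \le k} \|\nabla f(y_i)\|^2 \right) = 0.$$ If $r > 2$, then also $$\lim_{k \to \infty} \left[ k^2 \left( \min_{0 \le i \le k} f(y_i) - f(x^\star) \right) \right] = 0.$$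
   Context: $\|\cdot\|$ is the Euclidean norm. $\mathcal{F}_L^1(\mathbb{R}^d)$ is the class of $L$-smooth convex functions: differentiable $f : \mathbb{R}^d \to \mathbb{R}$ with $f(y) \ge f(x) + \langle \nabla f(x), y - x \rangle$ and $\|\nabla f(x) - \nabla f(y)\| \le L \|x - y\|$ for all $x, y \in \mathbb{R}^d$. $x^\star$ denotes a minimizer of $f$ (assumed to exist). Nesterov's accelerated gradient descent (\texttt{NAG}) with parameter $r$ and step size $s$: starting from $x_0 = y_0 \in \mathbb{R}^d$, for $k \ge 1$, $$x_k = y_{k-1} - s \nabla f(y_{k-1}), \qquad y_k = x_k + \frac{k-1}{k+r}(x_k - x_{k-1}).$$ *)

theory Defs
  imports "HOL-Analysis.Analysis"
begin

definition gradient :: "('a::real_inner \<Rightarrow> real) \<Rightarrow> 'a \<Rightarrow> 'a" where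
  "gradient f x = (THE D. GDERIV f x :> D)"

lemma gradient_eqI:
  assumes "GDERIV f x :> D"
  shows "gradient f x = D"
  unfolding gradient_def
proof (rule the_equality)
  show "GDERIV f x :> D" by (rule assms)
next
  fix D' assume "GDERIV f x :> D'"
  then have "(\<lambda>h. inner h D') = (\<lambda>h. inner h D)"
    using assms unfolding gderiv_def by (rule has_derivative_unique)
  then have "inner (D' - D) D' = inner (D' - D) D"
    by (rule fun_cong)
  then have "inner (D' - D) (D' - D) = 0"
    by (simp add: inner_diff_right)
  then show "D' = D" by simp
qed

lemma GDERIV_gradient:
  fixes f :: "'a::euclidean_space \<Rightarrow> real"
  assumes "f differentiable (at x)"
  shows "GDERIV f x :> gradient f x"
proof -
  obtain f' where f': "(f has_derivative f') (at x)"
    using assms unfolding differentiable_def by blast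
  then have lin: "linear f'"
    by (rule has_derivative_linear)
  have "f' h = inner h (adjoint f' 1)" for h
    using adjoint_works[OF lin, of h 1] by simp
  then have "f' = (\<lambda>h. inner h (adjoint f' 1))" by (rule ext)
  with f' have "GDERIV f x :> adjoint f' 1"
    unfolding gderiv_def by simp
  then show ?thesis using gradient_eqI by metis
qed

text \<open>The class of convex functions on Euclidean \<open>d\<close>-space, \<open>d = CARD('d)\<close>,
  whose gradient is Lipschitz with constant \<open>L\<close>.\<close>

definition smooth_convex :: "real \<Rightarrow> (real^'d \<Rightarrow> real) set" where
  "smooth_convex L = {f.
     (\<forall>x. f differentiable (at x)) \<and>
     (\<forall>x y. f y \<ge> f x + inner (gradient f x) (y - x)) \<and>
     (\<forall>x y. norm (gradient f x - gradient f y) \<le> L * norm (x - y))}"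

text \<open>\<open>NAG f r s x y\<close>: the sequences \<open>x\<close> and \<open>y\<close> are generated by Nesterov's accelerated
  gradient descent from the arbitrary starting point \<open>x 0\<close>. Note that the momentum coefficient
  vanishes for \<open>k = 1\<close>.\<close>

definition NAG ::
  "(real^'d \<Rightarrow> real) \<Rightarrow> real \<Rightarrow> real \<Rightarrow> (nat \<Rightarrow> real^'d) \<Rightarrow> (nat \<Rightarrow> real^'d) \<Rightarrow> bool" where
  "NAG f r s x y \<longleftrightarrow>
     x 0 = y 0 \<and>
     (\<forall>k\<ge>1. x k = y (k - 1) - s *\<^sub>R gradient f (y (k - 1)) \<and>
            y k = x k + ((real k - 1) / (real k + r)) *\<^sub>R (x k - x (k - 1)))"

end

theory Submission
  imports Defs
begin

text \<open>
  Put \<open>F\<^sub>k = f (y k) - f xstar\<close>, \<open>g\<^sub>k = gradient f (y k)\<close> and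
  \<open>z\<^sub>k = x k + ((k - 1) / r) (x k - x (k - 1))\<close>. The scheme becomes
  \<open>z\<^sub>k\<^sub>+\<^sub>1 = z\<^sub>k - s ((k + r) / r) g\<^sub>k\<close>, where \<open>z\<^sub>k = y k + (k / r) (y k - x k)\<close>.
  Expanding \<open>\<parallel>z\<^sub>k\<^sub>+\<^sub>1 - xstar\<parallel>\<^sup>2\<close> and using cocoercivity of the gradient at the pairs
  \<open>(xstar, y k)\<close> and \<open>(y (k - 1), y k)\<close>, all terms in \<open>\<parallel>g\<^sub>k\<parallel>\<^sup>2\<close> cancel, and
  \<open>r\<^sup>2 / 2 \<parallel>z\<^sub>k\<^sub>+\<^sub>1 - xstar\<parallel>\<^sup>2 + s (k + 1) (k + r + 1) F\<^sub>k\<close> decreases in each step by at least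
  \<open>s (k (r - 2) + r\<^sup>2 - r - 1) F\<^sub>k + (s\<^sup>2 / 2) k (k + r) \<parallel>g\<^sub>k\<^sub>-\<^sub>1\<parallel>\<^sup>2\<close>.
  Summation gives both explicit bounds as well as convergence of \<open>\<Sum> k\<^sup>2 \<parallel>g\<^sub>k\<parallel>\<^sup>2\<close> and,
  for \<open>r > 2\<close>, of \<open>\<Sum> k F\<^sub>k\<close>; the running minima being monotone, this yields the limits.
\<close>

section \<open>Limits of running minima from summability\<close>

text \<open>The block of indices from \<open>n div 2\<close> up to \<open>n\<close> has at least
  \<open>n / 2\<close> terms, each at least \<open>(n / 2) ^ p * m n\<close> because
  \<open>m\<close> decreases. Hence the scaled sequence is dominated by a block of partial sums,
  which tends to 0.\<close>

lemma tendsto_power_mult_decseq_if_summable: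
  fixes m :: "nat \<Rightarrow> real"
  assumes dec: "decseq m" and nonneg: "\<And>n. 0 \<le> m n"
    and sm: "summable (\<lambda>n. (real n + 1) ^ p * m n)"
  shows "(\<lambda>n. real n ^ Suc p * m n) \<longlonglongrightarrow> 0"
proof -
  define S where "S n = (\<Sum>i<n. (real i + 1) ^ p * m i)" for n
  obtain l where l: "S \<longlonglongrightarrow> l"
    using sm unfolding summable_iff_convergent convergent_def S_def by blast
  have half: "filterlim (\<lambda>n::nat. n div 2) at_top at_top"
    unfolding filterlim_at_top eventually_sequentially
  proof
    fix Z :: nat
    show "\<exists>N. \<forall>n\<ge>N. Z \<le> n div 2" by (intro exI[of _ "2 * Z"]) auto
  qed
  have "(\<lambda>n. S (n div 2)) \<longlonglongrightarrow> l"
    using filterlim_compose[OF l half] .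
  then have "(\<lambda>n. 2 ^ Suc p * (S n - S (n div 2))) \<longlonglongrightarrow> 2 ^ Suc p * (l - l)"
    using l by (intro tendsto_intros)
  then have lim: "(\<lambda>n. 2 ^ Suc p * (S n - S (n div 2))) \<longlonglongrightarrow> 0" by simp
  have bound: "real n ^ Suc p * m n \<le> 2 ^ Suc p * (S n - S (n div 2))" for n
  proof -
    have "S n - S (n div 2) = (\<Sum>i\<in>{n div 2..<n}. (real i + 1) ^ p * m i)"
      unfolding S_def lessThan_atLeast0 by (rule sum_diff_nat_ivl) auto
    also have "\<dots> \<ge> (\<Sum>i\<in>{n div 2..<n}. (real n / 2) ^ p * m n)"
    proof (rule sum_mono)
      fix i assume "i \<in> {n div 2..<n}"
      then have i: "n div 2 \<le> i" "i \<le> n" by auto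
      \<comment> \<open>The shift by one in the weight absorbs the rounding in
        \<open>n div 2\<close>.\<close>
      from i(1) have "n \<le> 2 * (i + 1)" by presburger
      then have "real n \<le> 2 * (real i + 1)"
        using of_nat_mono[of n "2 * (i + 1)", where 'a = real] by simp
      then have "(real n / 2) ^ p \<le> (real i + 1) ^ p"
        by (intro power_mono) auto
      then show "(real n / 2) ^ p * m n \<le> (real i + 1) ^ p * m i"
        using decseqD[OF dec i(2)] nonneg by (intro mult_mono) auto
    qed
    also have "(\<Sum>i\<in>{n div 2..<n}. (real n / 2) ^ p * m n)
        = real (n - n div 2) * ((real n / 2) ^ p * m n)"
      by simp
    also have "\<dots> \<ge> (real n / 2) * ((real n / 2) ^ p * m n)"
    proof (rule mult_right_mono)
      have "n \<le> 2 * (n - n div 2)" by presburger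
      then have "real n \<le> real (2 * (n - n div 2))" by (rule of_nat_mono)
      then show "real n / 2 \<le> real (n - n div 2)" by simp
    qed (simp add: nonneg)
    finally have "(real n / 2) ^ Suc p * m n \<le> S n - S (n div 2)"
      by (simp add: mult.assoc)
    then have "2 ^ Suc p * ((real n / 2) ^ Suc p * m n) \<le> 2 ^ Suc p * (S n - S (n div 2))"
      by (intro mult_left_mono) auto
    then show ?thesis by (simp add: power_divide)
  qed
  show ?thesis
    by (rule tendsto_sandwich[OF _ always_eventually[OF allI[OF bound]] tendsto_const lim])
      (simp add: nonneg)
qed

lemma Min_running_decseq:
  fixes a :: "nat \<Rightarrow> real"
  shows "decseq (\<lambda>k. MIN i\<in>{0..k}. a i)"
  by (rule decseq_SucI, rule Min_antimono) auto

lemma Min_running_le: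
  fixes a :: "nat \<Rightarrow> real"
  assumes "i \<le> k"
  shows "(MIN i\<in>{0..k}. a i) \<le> a i"
  using assms by (intro Min_le) auto

lemma Min_running_ge:
  fixes a :: "nat \<Rightarrow> real"
  assumes "\<And>i. c \<le> a i"
  shows "c \<le> (MIN i\<in>{0..k}. a i)"
  using assms by (subst Min_ge_iff) auto

text \<open>The running minimum at \<open>k\<close> is at most \<open>a k\<close>, so it inherits
  summability from \<open>a\<close>, and it decreases.\<close>

lemma tendsto_power_mult_Min_if_bounded_sums:
  fixes a :: "nat \<Rightarrow> real"
  assumes nonneg: "\<And>i. 0 \<le> a i - c"
    and bdd: "\<And>n. (\<Sum>i<n. (real i + 1) ^ p * (a i - c)) \<le> B"
  shows "(\<lambda>k. real k ^ Suc p * ((MIN i\<in>{0..k}. a i) - c)) \<longlonglongrightarrow> 0"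
proof (rule tendsto_power_mult_decseq_if_summable)
  show "decseq (\<lambda>k. (MIN i\<in>{0..k}. a i) - c)"
    using Min_running_decseq[of a] unfolding decseq_def by simp
  show "0 \<le> (MIN i\<in>{0..k}. a i) - c" for k
    using Min_running_ge[of c a k] nonneg by simp
  have "summable (\<lambda>i. (real i + 1) ^ p * (a i - c))"
    by (intro summableI_nonneg_bounded[OF _ bdd] mult_nonneg_nonneg nonneg) simp
  then show "summable (\<lambda>k. (real k + 1) ^ p * ((MIN i\<in>{0..k}. a i) - c))"
  proof (rule summable_comparison_test'[where N = 0])
    fix k
    have "0 \<le> (MIN i\<in>{0..k}. a i) - c"
      using Min_running_ge[of c a k] nonneg by simp
    moreover have "(MIN i\<in>{0..k}. a i) - c \<le> a k - c"
      using Min_running_le[of k k a] by simp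
    ultimately show "norm ((real k + 1) ^ p * ((MIN i\<in>{0..k}. a i) - c))
        \<le> (real k + 1) ^ p * (a k - c)"
      by (simp add: abs_mult mult_left_mono)
  qed
qed

text \<open>Total weight of the squared gradients in the energy estimate; source of the 6 and of
  \<open>2 * real k + 3 * r + 3\<close> in the gradient bound.\<close>

lemma sum_Suc_mult_Suc_add:
  "(\<Sum>i\<le>k. (real i + 1) * (real i + 1 + r))
     = (real k + 1) * (real k + 2) * (2 * real k + 3 * r + 3) / 6"
  by (induction k) (simp_all add: field_simps)

section \<open>Inequalities for smooth convex functions\<close>

text \<open>The gap between \<open>f\<close> and its quadratic model along
  \<open>x + t *\<^sub>R d\<close> has nonpositive derivative for \<open>t \<ge> 0\<close>, by
  Cauchy-Schwarz and the Lipschitz gradient.\<close>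

lemma smooth_convex_descent:
  fixes f :: "real^'d \<Rightarrow> real"
  assumes f: "f \<in> smooth_convex L"
  shows "f (x + d) \<le> f x + inner (gradient f x) d + L / 2 * (norm d)\<^sup>2"
proof -
  define h where "h t = f (x + t *\<^sub>R d) - t * inner (gradient f x) d - L / 2 * t\<^sup>2 * (norm d)\<^sup>2"
    for t :: real
  define h' where "h' t = inner (gradient f (x + t *\<^sub>R d)) d - inner (gradient f x) d
      - L * t * (norm d)\<^sup>2" for t :: real
  have deriv: "(h has_real_derivative h' t) (at t)" for t
  proof -
    have "(f has_derivative (\<lambda>v. inner v (gradient f (x + t *\<^sub>R d)))) (at (x + t *\<^sub>R d))"
      using f GDERIV_gradient[of f "x + t *\<^sub>R d"] unfolding smooth_convex_def gderiv_def by blast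
    moreover have "((\<lambda>t. x + t *\<^sub>R d) has_derivative (\<lambda>t. t *\<^sub>R d)) (at t)"
      by (auto intro!: derivative_eq_intros)
    ultimately have "((\<lambda>t. f (x + t *\<^sub>R d)) has_derivative
        (\<lambda>u. inner (u *\<^sub>R d) (gradient f (x + t *\<^sub>R d)))) (at t)"
      using diff_chain_at[of "\<lambda>t. x + t *\<^sub>R d" "\<lambda>t. t *\<^sub>R d" t f]
      by (simp add: o_def del: inner_scaleR_left)
    moreover have "(\<lambda>u. inner (u *\<^sub>R d) (gradient f (x + t *\<^sub>R d)))
        = (*) (inner (gradient f (x + t *\<^sub>R d)) d)"
      by (rule ext) (simp add: inner_commute)
    ultimately have "((\<lambda>t. f (x + t *\<^sub>R d)) has_real_derivative
        inner (gradient f (x + t *\<^sub>R d)) d) (at t)"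
      by (simp only: has_field_derivative_def)
    then show ?thesis
      unfolding h_def h'_def by (auto intro!: derivative_eq_intros)
  qed
  have "h' t \<le> 0" if "0 \<le> t" for t
  proof -
    have "inner (gradient f (x + t *\<^sub>R d) - gradient f x) d
        \<le> norm (gradient f (x + t *\<^sub>R d) - gradient f x) * norm d"
      by (rule norm_cauchy_schwarz)
    also have "\<dots> \<le> (L * norm ((x + t *\<^sub>R d) - x)) * norm d"
      using f unfolding smooth_convex_def by (intro mult_right_mono) (blast, simp)
    also have "\<dots> = L * t * (norm d)\<^sup>2"
      using that by (simp add: power2_eq_square)
    finally show ?thesis by (simp add: h'_def inner_diff_left)
  qed
  then have "h 1 \<le> h 0"
    using deriv by (intro DERIV_nonpos_imp_nonincreasing[of 0 1 h]) auto
  then show ?thesis by (simp add: h_def)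
qed

text \<open>The direction stays arbitrary: it will be a difference of gradients for cocoercivity and
  the gradient itself for the gap to the minimum.\<close>

lemma smooth_convex_gradient_step:
  fixes f :: "real^'d \<Rightarrow> real"
  assumes f: "f \<in> smooth_convex L" and L: "L > 0" and s: "0 < s" "s \<le> 1 / L"
  shows "f (x - s *\<^sub>R d) \<le> f x - s * inner (gradient f x) d + s / 2 * (norm d)\<^sup>2"
proof -
  have "L * s \<le> 1" using s L by (simp add: field_simps)
  then have "s * (L * s) \<le> s * 1" using s by (intro mult_left_mono) auto
  then have "L / 2 * s\<^sup>2 * (norm d)\<^sup>2 \<le> s / 2 * (norm d)\<^sup>2"
    by (intro mult_right_mono) (auto simp: power2_eq_square mult_ac)
  then show ?thesis
    using smooth_convex_descent[OF f, of x "- s *\<^sub>R d"]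
    by (simp add: power_mult_distrib)
qed

text \<open>Evaluate \<open>f\<close> at \<open>x - s *\<^sub>R d\<close>, with \<open>d\<close> the
  gradient difference: convexity at \<open>y\<close> bounds it below, the step inequality above. The
  constant \<open>s / 2\<close> is the one for which the squared gradients later cancel
  exactly.\<close>

lemma smooth_convex_cocoercive:
  fixes f :: "real^'d \<Rightarrow> real"
  assumes f: "f \<in> smooth_convex L" and L: "L > 0" and s: "0 < s" "s \<le> 1 / L"
  shows "f x \<ge> f y + inner (gradient f y) (x - y)
           + s / 2 * (norm (gradient f x - gradient f y))\<^sup>2"
proof -
  define d where "d = gradient f x - gradient f y"
  have "f y + inner (gradient f y) ((x - s *\<^sub>R d) - y) \<le> f (x - s *\<^sub>R d)"
    using f unfolding smooth_convex_def by blast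
  also have "\<dots> \<le> f x - s * inner (gradient f x) d + s / 2 * (norm d)\<^sup>2"
    by (rule smooth_convex_gradient_step[OF assms])
  finally have "f y + inner (gradient f y) (x - y) + s * inner d d - s / 2 * (norm d)\<^sup>2 \<le> f x"
    by (simp add: d_def inner_diff_left inner_diff_right algebra_simps)
  then show ?thesis by (simp add: d_def power2_norm_eq_inner)
qed

text \<open>A gradient step from \<open>x\<close> cannot go below the minimum.\<close>

lemma smooth_convex_gap_ge:
  fixes f :: "real^'d \<Rightarrow> real"
  assumes f: "f \<in> smooth_convex L" and L: "L > 0" and s: "0 < s" "s \<le> 1 / L"
    and min: "\<forall>z. f xstar \<le> f z"
  shows "s / 2 * (norm (gradient f x))\<^sup>2 \<le> f x - f xstar"
  using smooth_convex_gradient_step[OF assms(1-4), of x "gradient f x"]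
    min[rule_format, of "x - s *\<^sub>R gradient f x"]
  by (simp add: power2_norm_eq_inner)

lemma smooth_convex_gradient_minimizer:
  fixes f :: "real^'d \<Rightarrow> real"
  assumes "f \<in> smooth_convex L" and "L > 0" and min: "\<forall>z. f xstar \<le> f z"
  shows "gradient f xstar = 0"
  using smooth_convex_gap_ge[OF assms(1,2) _ _ min, of "1 / L" xstar] \<open>L > 0\<close>
  by (simp add: divide_le_0_iff zero_le_divide_iff)

section \<open>Energy estimate for the accelerated scheme\<close>

text \<open>At \<open>k = 0\<close> truncated subtraction turns \<open>x (k - 1)\<close> into
  \<open>x 0\<close>, so the coefficient \<open>- 1 / r\<close> multiplies zero.\<close>

definition nag_z :: "real \<Rightarrow> (nat \<Rightarrow> real^'d) \<Rightarrow> nat \<Rightarrow> real^'d" where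
  "nag_z r x k = x k + ((real k - 1) / r) *\<^sub>R (x k - x (k - 1))"

lemma nag_z_0 [simp]: "nag_z r x 0 = x 0"
  by (simp add: nag_z_def)

text \<open>For \<open>k \<ge> 1\<close>, the momentum rule times \<open>real k + r\<close> trades
  the velocity \<open>x k - x (k - 1)\<close> for \<open>y k - x k\<close>. Scaling by
  \<open>r\<close> avoids divisions.\<close>

lemma nag_z_eq:
  assumes "NAG f r s x y" and r: "r > 0"
  shows "r *\<^sub>R nag_z r x k = r *\<^sub>R y k + real k *\<^sub>R (y k - x k)"
proof (cases "k = 0")
  case True
  then show ?thesis using assms(1) by (simp add: NAG_def)
next
  case False
  then have "y k = x k + ((real k - 1) / (real k + r)) *\<^sub>R (x k - x (k - 1))"
    using assms(1) by (simp add: NAG_def)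
  then have "(real k + r) *\<^sub>R (y k - x k) = (real k - 1) *\<^sub>R (x k - x (k - 1))"
    using r by simp
  moreover have "r *\<^sub>R nag_z r x k = r *\<^sub>R x k + (real k - 1) *\<^sub>R (x k - x (k - 1))"
    using r by (simp add: nag_z_def scaleR_add_right)
  ultimately have "r *\<^sub>R nag_z r x k = r *\<^sub>R x k + (real k + r) *\<^sub>R (y k - x k)"
    by (simp only:)
  then show ?thesis by (simp add: scaleR_add_left scaleR_diff_right)
qed

text \<open>At index \<open>Suc k\<close> the velocity has weight \<open>real k\<close>, so the
  gradient step enters with total weight \<open>real k + r\<close>.\<close>

lemma nag_z_Suc:
  assumes nag: "NAG f r s x y" and r: "r > 0"
  shows "r *\<^sub>R nag_z r x (Suc k) = r *\<^sub>R nag_z r x k - (s * (real k + r)) *\<^sub>R gradient f (y k)"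
proof -
  have "x (Suc k) = y k - s *\<^sub>R gradient f (y k)"
    using nag unfolding NAG_def by force
  moreover have "r *\<^sub>R nag_z r x (Suc k) = r *\<^sub>R x (Suc k) + real k *\<^sub>R (x (Suc k) - x k)"
    using r by (simp add: nag_z_def scaleR_add_right)
  ultimately show ?thesis
    unfolding nag_z_eq[OF assms, of k]
    by (simp add: scaleR_add_left scaleR_diff_right distrib_left mult.commute)
qed

lemma nag_energy_step:
  fixes f :: "real^'d \<Rightarrow> real"
  assumes f: "f \<in> smooth_convex L" and L: "L > 0" and s: "0 < s" "s \<le> 1 / L"
    and min: "\<forall>z. f xstar \<le> f z" and r: "r > 0" and nag: "NAG f r s x y"
  shows "(norm (r *\<^sub>R (nag_z r x (Suc k) - xstar)))\<^sup>2 / 2 + s * (real k + r)\<^sup>2 * (f (y k) - f xstar)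
    \<le> (norm (r *\<^sub>R (nag_z r x k - xstar)))\<^sup>2 / 2
      + s * real k * (real k + r) * (f (y (k - 1)) - f xstar)
      - s\<^sup>2 / 2 * real k * (real k + r) * (norm (gradient f (y (k - 1))))\<^sup>2"
proof -
  define g where "g = gradient f (y k)"
  define g' where "g' = gradient f (y (k - 1))"
  define F where "F = f (y k) - f xstar"
  define F' where "F' = f (y (k - 1)) - f xstar"
  define w where "w = r *\<^sub>R (nag_z r x k - xstar)"
  define a where "a = real k + r"
  have a: "a > 0" using r by (simp add: a_def)
  have w: "w = r *\<^sub>R (y k - xstar) + real k *\<^sub>R (y k - x k)"
    using nag_z_eq[OF nag r, of k] by (simp add: w_def algebra_simps)
  have star: "F + s / 2 * (norm g)\<^sup>2 \<le> inner g (y k - xstar)"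
    using smooth_convex_cocoercive[OF f L s, where x = xstar and y = "y k"]
      smooth_convex_gradient_minimizer[OF f L min]
    by (simp add: F_def g_def inner_diff_right)
  \<comment> \<open>The factor \<open>real k\<close> makes the case \<open>k = 0\<close>, where
    \<open>y (k - 1)\<close> is just \<open>y 0\<close>, trivial.\<close>
  have prev: "real k * (F - F' + s / 2 * (norm g)\<^sup>2 + s / 2 * (norm g')\<^sup>2)
      \<le> real k * inner g (y k - x k)"
  proof (cases "k = 0")
    case False
    then have xk: "x k = y (k - 1) - s *\<^sub>R g'"
      using nag by (simp add: NAG_def g'_def)
    have "f (y k) + inner g (y (k - 1) - y k) + s / 2 * (norm (g' - g))\<^sup>2 \<le> f (y (k - 1))"
      using smooth_convex_cocoercive[OF f L s, of "y k" "y (k - 1)"] by (simp add: g_def g'_def)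
    \<comment> \<open>The cross term \<open>s * inner g g'\<close> is absorbed by the gradient step
      hidden in \<open>x k\<close>, since
      \<open>y k - x k = (y k - y (k - 1)) + s *\<^sub>R g'\<close>.\<close>
    moreover have "s / 2 * (norm (g' - g))\<^sup>2
        = s / 2 * (norm g)\<^sup>2 + s / 2 * (norm g')\<^sup>2 - s * inner g g'"
      by (simp add: power2_norm_eq_inner inner_diff_left inner_diff_right inner_commute
          algebra_simps)
    ultimately have "F - F' + s / 2 * (norm g)\<^sup>2 + s / 2 * (norm g')\<^sup>2 \<le> inner g (y k - x k)"
      unfolding xk F_def F'_def inner_diff_right inner_scaleR_right by linarith
    then show ?thesis by (intro mult_left_mono) auto
  qed simp
  have "a * F - real k * F' + a * s / 2 * (norm g)\<^sup>2 + real k * s / 2 * (norm g')\<^sup>2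
      = r * (F + s / 2 * (norm g)\<^sup>2)
        + real k * (F - F' + s / 2 * (norm g)\<^sup>2 + s / 2 * (norm g')\<^sup>2)"
    by (simp add: a_def algebra_simps)
  also have "\<dots> \<le> r * inner g (y k - xstar) + real k * inner g (y k - x k)"
    using star r by (intro add_mono mult_left_mono prev) auto
  also have "\<dots> = inner g w" by (simp add: w inner_add_right)
  finally have main: "s * a * (a * F - real k * F' + a * s / 2 * (norm g)\<^sup>2 + real k * s / 2 * (norm g')\<^sup>2)
      \<le> s * a * inner g w"
    using s a by (intro mult_left_mono) auto
  have next_w: "r *\<^sub>R (nag_z r x (Suc k) - xstar) = w - (s * a) *\<^sub>R g"
    using nag_z_Suc[OF nag r, of k] by (simp add: w_def a_def g_def algebra_simps)
  have "(norm (w - c *\<^sub>R g))\<^sup>2 = (norm w)\<^sup>2 - 2 * (c * inner g w) + c\<^sup>2 * (norm g)\<^sup>2"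
    for c :: real
    unfolding power2_norm_eq_inner
    by (simp add: inner_diff_left inner_diff_right inner_commute power2_eq_square algebra_simps)
  from this[of "s * a"] have "(norm (r *\<^sub>R (nag_z r x (Suc k) - xstar)))\<^sup>2
      = (norm w)\<^sup>2 - 2 * (s * a * inner g w) + (s * a)\<^sup>2 * (norm g)\<^sup>2"
    by (simp only: next_w)
  \<comment> \<open>The squared norm of \<open>g\<close> gets the coefficient
    \<open>(s * a)^2 / 2\<close>, exactly what half of the expanded square contributes.\<close>
  moreover have "s * a * (a * F - real k * F' + a * s / 2 * (norm g)\<^sup>2 + real k * s / 2 * (norm g')\<^sup>2)
      = s * a\<^sup>2 * F - s * real k * a * F' + (s * a)\<^sup>2 * (norm g)\<^sup>2 / 2
        + s\<^sup>2 / 2 * real k * a * (norm g')\<^sup>2"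
    by (simp add: power2_eq_square algebra_simps)
  ultimately have "(norm (r *\<^sub>R (nag_z r x (Suc k) - xstar)))\<^sup>2 / 2 + s * a\<^sup>2 * F
      \<le> (norm w)\<^sup>2 / 2 + s * real k * a * F' - s\<^sup>2 / 2 * real k * a * (norm g')\<^sup>2"
    using main by linarith
  then show ?thesis by (simp only: w_def a_def F_def F'_def g'_def)
qed

text \<open>Telescoping: the weight of the gap left over at step \<open>k\<close> is the one that
  step \<open>k + 1\<close> consumes. The gradient sum stops before \<open>k\<close> because each
  step yields the gradient at the previous index.\<close>

lemma nag_energy_sum:
  fixes f :: "real^'d \<Rightarrow> real"
  assumes f: "f \<in> smooth_convex L" and L: "L > 0" and s: "0 < s" "s \<le> 1 / L"
    and min: "\<forall>z. f xstar \<le> f z" and r: "r > 0" and nag: "NAG f r s x y"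
  shows "(norm (r *\<^sub>R (nag_z r x (Suc k) - xstar)))\<^sup>2 / 2
      + s * (real k + 1) * (real k + 1 + r) * (f (y k) - f xstar)
      + s * (\<Sum>i\<le>k. (real i * (r - 2) + r\<^sup>2 - r - 1) * (f (y i) - f xstar))
      + s\<^sup>2 / 2 * (\<Sum>i<k. (real i + 1) * (real i + 1 + r) * (norm (gradient f (y i)))\<^sup>2)
    \<le> r\<^sup>2 * (norm (x 0 - xstar))\<^sup>2 / 2"
proof -
  define N where "N k = (norm (r *\<^sub>R (nag_z r x (Suc k) - xstar)))\<^sup>2 / 2" for k
  define T where "T k = s * (real k + 1) * (real k + 1 + r) * (f (y k) - f xstar)" for k
  define C where "C k = (real k * (r - 2) + r\<^sup>2 - r - 1) * (f (y k) - f xstar)" for k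
  define H where "H k = (real k + 1) * (real k + 1 + r) * (norm (gradient f (y k)))\<^sup>2" for k
  \<comment> \<open>The weight \<open>(real k + r)^2\<close> splits into the part passed on to the
    next step and a surplus that is collected in the sum.\<close>
  have split: "T k + s * C k = s * (real k + r)\<^sup>2 * (f (y k) - f xstar)" for k
  proof -
    have "(real k + 1) * (real k + 1 + r) + (real k * (r - 2) + r\<^sup>2 - r - 1) = (real k + r)\<^sup>2"
      by (simp add: power2_eq_square algebra_simps)
    then show ?thesis
      unfolding T_def C_def by (metis distrib_left distrib_right mult.assoc)
  qed
  have "N k + T k + s * (\<Sum>i\<le>k. C i) + s\<^sup>2 / 2 * (\<Sum>i<k. H i)
      \<le> r\<^sup>2 * (norm (x 0 - xstar))\<^sup>2 / 2"
  proof (induction k)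
    case 0
    show ?case
      using nag_energy_step[OF assms, of 0] split[of 0] by (simp add: N_def power_mult_distrib)
  next
    case (Suc k)
    have "N (Suc k) + (T (Suc k) + s * C (Suc k)) \<le> N k + T k - s\<^sup>2 / 2 * H k"
      using nag_energy_step[OF assms, of "Suc k"] unfolding split
      by (simp add: N_def T_def H_def mult.assoc add.commute)
    then show ?case
      using Suc.IH by (simp add: distrib_left)
  qed
  then show ?thesis by (simp only: N_def T_def C_def H_def)
qed

text \<open>For \<open>r \<ge> 2\<close> all summands of the energy estimate are nonnegative, so
  each can be bounded alone.\<close>

lemma nag_energy_bounds:
  fixes f :: "real^'d \<Rightarrow> real"
  assumes f: "f \<in> smooth_convex L" and L: "L > 0" and s: "0 < s" "s \<le> 1 / L"
    and min: "\<forall>z. f xstar \<le> f z" and r: "r \<ge> 2" and nag: "NAG f r s x y"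
  defines "R \<equiv> r\<^sup>2 * (norm (x 0 - xstar))\<^sup>2"
  shows "s * (real k + 1) * (real k + 1 + r) * (f (y k) - f xstar) \<le> R / 2"
    and "(\<Sum>i\<le>k. (real i + 1) * (real i + 1 + r) * (norm (gradient f (y i)))\<^sup>2) \<le> R / s\<^sup>2"
    and "(r - 2) * (\<Sum>i<k. (real i + 1) * (f (y i) - f xstar)) \<le> R / (2 * s)"
proof -
  define F where "F i = f (y i) - f xstar" for i
  define G where "G i = (norm (gradient f (y i)))\<^sup>2" for i
  define A where "A k = (\<Sum>i\<le>k. (real i * (r - 2) + r\<^sup>2 - r - 1) * F i)" for k
  define B where "B k = (\<Sum>i<k. (real i + 1) * (real i + 1 + r) * G i)" for k
  have F: "0 \<le> F i" for i using min by (simp add: F_def)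
  have FG: "s / 2 * G i \<le> F i" for i
    unfolding F_def G_def by (rule smooth_convex_gap_ge[OF f L s min])
  have "r * r \<ge> 2 * r" using r by (intro mult_right_mono) auto
  then have r2: "r\<^sup>2 - r - 1 \<ge> r - 2" "r\<^sup>2 - r - 1 \<ge> 0"
    using r unfolding power2_eq_square by linarith+
  have coeff: "(r - 2) * (real i + 1) \<le> real i * (r - 2) + r\<^sup>2 - r - 1"
    "0 \<le> real i * (r - 2) + r\<^sup>2 - r - 1" for i
  proof -
    show "(r - 2) * (real i + 1) \<le> real i * (r - 2) + r\<^sup>2 - r - 1"
      using r2 by (simp add: algebra_simps)
    moreover have "0 \<le> (r - 2) * (real i + 1)" using r by simp
    ultimately show "0 \<le> real i * (r - 2) + r\<^sup>2 - r - 1" by linarith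
  qed
  have A: "0 \<le> s * A k" for k
    unfolding A_def using s F coeff(2) by (intro mult_nonneg_nonneg sum_nonneg) auto
  have B: "0 \<le> s\<^sup>2 / 2 * B k" for k
    unfolding B_def G_def using s r by (intro mult_nonneg_nonneg sum_nonneg) auto
  have T: "0 \<le> s * (real k + 1) * (real k + 1 + r) * F k" for k
    using s r F by (intro mult_nonneg_nonneg) auto
  have sum: "s * (real k + 1) * (real k + 1 + r) * F k + s * A k + s\<^sup>2 / 2 * B k \<le> R / 2" for k
    using nag_energy_sum[OF f L s min _ nag, of k] r
      zero_le_power2[of "norm (r *\<^sub>R (nag_z r x (Suc k) - xstar))"]
    unfolding F_def G_def A_def B_def R_def by linarith
  show "s * (real k + 1) * (real k + 1 + r) * (f (y k) - f xstar) \<le> R / 2"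
    using sum[of k] A[of k] B[of k] by (simp add: F_def)
  \<comment> \<open>The missing gradient term at index \<open>k\<close> is paid for by the gap
    \<open>F k\<close>, with just the weight that continues the sum.\<close>
  have "s * (real k + 1) * (real k + 1 + r) * (s / 2 * G k)
      \<le> s * (real k + 1) * (real k + 1 + r) * F k"
    using FG s r by (intro mult_left_mono) auto
  moreover have "B (Suc k) = B k + (real k + 1) * (real k + 1 + r) * G k"
    by (simp add: B_def)
  then have "s\<^sup>2 / 2 * B (Suc k)
      = s\<^sup>2 / 2 * B k + s * (real k + 1) * (real k + 1 + r) * (s / 2 * G k)"
    by (simp add: power2_eq_square algebra_simps)
  ultimately have "s\<^sup>2 / 2 * B (Suc k) \<le> R / 2"
    using sum[of k] A[of k] by linarith
  then have "B (Suc k) \<le> R / s\<^sup>2" using s by (simp add: field_simps)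
  then show "(\<Sum>i\<le>k. (real i + 1) * (real i + 1 + r) * (norm (gradient f (y i)))\<^sup>2) \<le> R / s\<^sup>2"
    by (simp add: B_def G_def lessThan_Suc_atMost)
  have "(r - 2) * (\<Sum>i<k. (real i + 1) * F i) = (\<Sum>i<k. ((r - 2) * (real i + 1)) * F i)"
    by (simp add: sum_distrib_left mult_ac)
  also have "\<dots> \<le> (\<Sum>i<k. (real i * (r - 2) + r\<^sup>2 - r - 1) * F i)"
    by (intro sum_mono mult_right_mono coeff F)
  also have "\<dots> \<le> A k"
    unfolding A_def using F coeff(2) by (intro sum_mono2) auto
  also have "\<dots> \<le> R / (2 * s)"
    using sum[of k] T[of k] B[of k] s by (simp add: field_simps)
  finally show "(r - 2) * (\<Sum>i<k. (real i + 1) * (f (y i) - f xstar)) \<le> R / (2 * s)"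
    by (simp add: F_def)
qed

section \<open>From the energy bounds to rates and limits\<close>

theorem theorem3p1:
  fixes f :: "real^'d \<Rightarrow> real"
    and L r s :: real
    and xstar :: "real^'d"
    and x y :: "nat \<Rightarrow> real^'d"
  assumes "L > 0"
    and "f \<in> smooth_convex L"
    and "\<forall>z. f xstar \<le> f z"
    and "r \<ge> 2"
    and "0 < s" and "s \<le> 1 / L"
    and "NAG f r s x y"
  shows "(\<forall>k::nat.
            f (y k) - f xstar
              \<le> r\<^sup>2 * (norm (x 0 - xstar))\<^sup>2 / (2 * s * (real k + 1) * (real k + r + 1)) \<and>
            (MIN i\<in>{0..k}. (norm (gradient f (y i)))\<^sup>2)
              \<le> 6 * r\<^sup>2 * (norm (x 0 - xstar))\<^sup>2
                 / (s\<^sup>2 * (real k + 1) * (real k + 2) * (2 * real k + 3 * r + 3))) \<and>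
         (\<lambda>k. real k ^ 3 * (MIN i\<in>{0..k}. (norm (gradient f (y i)))\<^sup>2)) \<longlonglongrightarrow> 0 \<and>
         (r > 2 \<longrightarrow>
            (\<lambda>k. real k ^ 2 * ((MIN i\<in>{0..k}. f (y i)) - f xstar)) \<longlonglongrightarrow> 0)"
proof (intro conjI allI impI)
  note b = nag_energy_bounds[OF assms(2,1,5,6,3,4,7)]
  define G where "G i = (norm (gradient f (y i)))\<^sup>2" for i
  define R where "R = r\<^sup>2 * (norm (x 0 - xstar))\<^sup>2"
  fix k :: nat
  have "0 < 2 * s * (real k + 1) * (real k + r + 1)"
    using assms(4,5) by (intro mult_pos_pos) auto
  then show "f (y k) - f xstar
      \<le> r\<^sup>2 * (norm (x 0 - xstar))\<^sup>2 / (2 * s * (real k + 1) * (real k + r + 1))"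
    using b(1)[of k] by (subst pos_le_divide_eq) (simp_all add: algebra_simps)
  define m where "m = (MIN i\<in>{0..k}. G i)"
  define D where "D = (real k + 1) * (real k + 2) * (2 * real k + 3 * r + 3)"
  have D: "D > 0" unfolding D_def using assms(4) by (intro mult_pos_pos) auto
  \<comment> \<open>Replacing every squared gradient by the minimum \<open>m\<close> leaves
    \<open>m\<close> times the sum of the weights, \<open>D / 6\<close>.\<close>
  have "D / 6 * m = (\<Sum>i\<le>k. (real i + 1) * (real i + 1 + r) * m)"
    unfolding D_def sum_Suc_mult_Suc_add[symmetric] by (simp add: sum_distrib_right)
  also have "\<dots> \<le> (\<Sum>i\<le>k. (real i + 1) * (real i + 1 + r) * G i)"
    unfolding m_def using assms(4) by (intro sum_mono mult_left_mono Min_running_le) auto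
  also have "\<dots> \<le> R / s\<^sup>2" unfolding G_def R_def by (rule b(2))
  finally have "m * (s\<^sup>2 * D) \<le> 6 * R" using assms(5) by (simp add: field_simps)
  then have "m \<le> 6 * R / (s\<^sup>2 * D)"
    using D assms(5) by (subst pos_le_divide_eq) auto
  then show "(MIN i\<in>{0..k}. (norm (gradient f (y i)))\<^sup>2)
      \<le> 6 * r\<^sup>2 * (norm (x 0 - xstar))\<^sup>2
         / (s\<^sup>2 * (real k + 1) * (real k + 2) * (2 * real k + 3 * r + 3))"
    by (simp add: m_def D_def G_def R_def mult.assoc)
next
  note b = nag_energy_bounds[OF assms(2,1,5,6,3,4,7)]
  define G where "G i = (norm (gradient f (y i)))\<^sup>2" for i
  define C where "C = r\<^sup>2 * (norm (x 0 - xstar))\<^sup>2 / s\<^sup>2"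
  \<comment> \<open>Dropping \<open>r\<close> from the weights leaves exponent 2, hence the rate
    with \<open>k ^ 3\<close>.\<close>
  have "(\<Sum>i<n. (real i + 1)\<^sup>2 * (G i - 0)) \<le> C" for n
  proof -
    have "(\<Sum>i<n. (real i + 1)\<^sup>2 * (G i - 0)) \<le> (\<Sum>i\<le>n. (real i + 1)\<^sup>2 * G i)"
      unfolding G_def diff_0_right by (intro sum_mono2) auto
    also have "\<dots> \<le> (\<Sum>i\<le>n. (real i + 1) * (real i + 1 + r) * G i)"
      using assms(4) unfolding power2_eq_square G_def
      by (intro sum_mono mult_right_mono mult_left_mono) auto
    also have "\<dots> \<le> C" unfolding G_def C_def by (rule b(2))
    finally show ?thesis .
  qed
  then show "(\<lambda>k. real k ^ 3 * (MIN i\<in>{0..k}. (norm (gradient f (y i)))\<^sup>2)) \<longlonglongrightarrow> 0"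
    using tendsto_power_mult_Min_if_bounded_sums[of G 0 2 C]
    by (simp add: G_def numeral_3_eq_3 numeral_2_eq_2)
next
  note b = nag_energy_bounds[OF assms(2,1,5,6,3,4,7)]
  define C where "C = r\<^sup>2 * (norm (x 0 - xstar))\<^sup>2 / (2 * s) / (r - 2)"
  assume "r > 2"
  \<comment> \<open>Dividing by \<open>r - 2 > 0\<close> bounds the gap sums with exponent 1, hence
    the rate with \<open>k ^ 2\<close>.\<close>
  then have "(\<Sum>i<n. (real i + 1) ^ 1 * (f (y i) - f xstar)) \<le> C" for n
    using b(3)[of n] unfolding C_def by (subst pos_le_divide_eq) (simp_all add: mult.commute)
  then show "(\<lambda>k. real k ^ 2 * ((MIN i\<in>{0..k}. f (y i)) - f xstar)) \<longlonglongrightarrow> 0"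
    using tendsto_power_mult_Min_if_bounded_sums[of "\<lambda>i. f (y i)" "f xstar" 1 C] assms(3)
    by (simp add: numeral_2_eq_2)
qed

end
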